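(* Let $S\subset\mathbb{R}^n$ be compact and convex, let $a,c\in\mathbb{R}^n$ and $g,h\in\mathbb{R}$ satisfy $c^Tx+h>0$ for all $x\in S$, let $\|\cdot\|$ be a norm on $\mathbb{R}^n$, and let $\delta>0$. For $x\in S$ consider the problem $$(\mathrm{F}_x)\qquad \tilde f(x):=\max_{y}\ \left\{\frac{a^Ty+g}{c^Ty+h}\ :\ \|y-x\|\le\delta,\ y\in S\right\}.$$ If $x\in S$, then $\tilde f(x)$ is the optimal objective value of the following convex optimization problem: $$(\mathrm{C}_x)\qquad \begin{array}{ll}\max\limits_{\bar y,\theta} & a^T\bar y+g\theta\\ \text{s.t.} & \|\bar y-\theta x\|\le\theta\delta,\\ & c^T\bar y+h\theta=1,\\ & \bar y\in\theta S,\\ & \theta\ge0,\end{array}$$ with variables $\bar y\in\mathbb{R}^n$, $\theta\in\mathbb{R}$. If $(\bar y,\theta)$ is feasible for $(\mathrm{C}_x)$, then $y=\bar y/\theta$ is feasible for $(\mathrm{F}_x)$; and if $(\bar y,\theta)$ is optimal for $(\mathrm{C}_x)$, then $y=\bar y/\theta$ is optimal for $(\mathrm{F}_x)$.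
   Context: For $\theta\ge0$, $\theta S:=\{\theta s: s\in S\}$ denotes the scaling of $S$ by $\theta$; for $\theta=0$, $\theta S=\{0\}$. *)

theory Defs
  imports "HOL-Analysis.Analysis"
begin

(* An arbitrary norm as a function: the type class norm of real ^ 'n is fixed to the Euclidean one. *)
definition is_norm :: "('a::real_vector \<Rightarrow> real) \<Rightarrow> bool" where
  "is_norm N \<longleftrightarrow>
     (\<forall>v. 0 \<le> N v) \<and>
     (\<forall>v. N v = 0 \<longleftrightarrow> v = 0) \<and>
     (\<forall>r v. N (r *\<^sub>R v) = \<bar>r\<bar> * N v) \<and>
     (\<forall>v w. N (v + w) \<le> N v + N w)"

(* A maximum, hence attained, as opposed to a mere supremum. *)
definition has_max_value :: "('b \<Rightarrow> real) \<Rightarrow> 'b set \<Rightarrow> real \<Rightarrow> bool" where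
  "has_max_value f X v \<longleftrightarrow> (\<exists>z. is_arg_max f (\<lambda>w. w \<in> X) z \<and> f z = v)"

definition convex_max_problem :: "('b::real_vector \<Rightarrow> real) \<Rightarrow> 'b set \<Rightarrow> bool" where
  "convex_max_problem f X \<longleftrightarrow> convex X \<and> concave_on X f"

definition F_feas ::
    "('a::real_vector \<Rightarrow> real) \<Rightarrow> real \<Rightarrow> 'a set \<Rightarrow> 'a \<Rightarrow> 'a set" where
  "F_feas N \<delta> S x = {y. N (y - x) \<le> \<delta> \<and> y \<in> S}"

definition F_obj ::
    "'a::real_inner \<Rightarrow> real \<Rightarrow> 'a \<Rightarrow> real \<Rightarrow> 'a \<Rightarrow> real" where
  "F_obj a g c h y = (a \<bullet> y + g) / (c \<bullet> y + h)"

definition f_tilde ::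
    "('a::real_inner \<Rightarrow> real) \<Rightarrow> real \<Rightarrow> 'a set \<Rightarrow> 'a \<Rightarrow> real \<Rightarrow> 'a \<Rightarrow> real \<Rightarrow> 'a \<Rightarrow> real" where
  "f_tilde N \<delta> S a g c h x = (THE v. has_max_value (F_obj a g c h) (F_feas N \<delta> S x) v)"

(* For nonempty S, the image (\<lambda>s. \<theta> *\<^sub>R s) ` S at \<theta> = 0 is {0}. *)
definition C_feas ::
    "('a::real_inner \<Rightarrow> real) \<Rightarrow> real \<Rightarrow> 'a set \<Rightarrow> 'a \<Rightarrow> real \<Rightarrow> 'a \<Rightarrow> ('a \<times> real) set" where
  "C_feas N \<delta> S c h x =
     {(y, \<theta>). N (y - \<theta> *\<^sub>R x) \<le> \<theta> * \<delta> \<and>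
              c \<bullet> y + h * \<theta> = 1 \<and>
              y \<in> (\<lambda>s. \<theta> *\<^sub>R s) ` S \<and>
              \<theta> \<ge> 0}"

definition C_obj :: "'a::real_inner \<Rightarrow> real \<Rightarrow> 'a \<times> real \<Rightarrow> real" where
  "C_obj a g = (\<lambda>(y, \<theta>). a \<bullet> y + g * \<theta>)"

end

theory Submission
  imports Defs
begin

text \<open>
  The result is the Charnes--Cooper transformation of a linear fractional program. At
  \<open>\<theta> = 0\<close> the constraints of the second problem would force \<open>y = 0\<close>, which violates the
  normalisation \<open>c \<bullet> y + h * \<theta> = 1\<close>. So \<open>\<theta> > 0\<close> on its feasible set, and this set is the
  cone over the feasible set \<open>K\<close> of the first problem, sliced by the hyperplane
  \<open>c \<bullet> y + h * \<theta> = 1\<close> (lemma \<open>C_feas_iff\<close>). Since \<open>c \<bullet> y + h\<close> is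
  positive on \<open>K\<close>, each ray of the cone meets the hyperplane in exactly one point: rays correspond
  to points \<open>y\<close> of \<open>K\<close>, and the scaling factor is \<open>\<theta> = 1 / (c \<bullet> y + h)\<close>. On the slice the
  denominator of the fraction has been normalised to one, so the linear objective there takes the
  value of the fraction at the corresponding point of \<open>K\<close> (lemmas \<open>F_obj_project\<close> and
  \<open>C_obj_lift\<close>). Maximisers and maximum values therefore correspond as well.

  The second problem is convex because the cone over the convex set \<open>K\<close> is convex
  (lemma \<open>convex_perspective_cone\<close>). The maximum in the first problem is attained because a norm
  on a finite-dimensional space is a convex function, hence continuous, so that \<open>K\<close> is compact.
\<close>

lemma is_norm_convex_on:
  assumes "is_norm N"
  shows "convex_on UNIV N"
proof (rule convex_onI)
  fix t :: real and v w
  assume t: "0 < t" "t < 1"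
  have "N ((1 - t) *\<^sub>R v + t *\<^sub>R w) \<le> N ((1 - t) *\<^sub>R v) + N (t *\<^sub>R w)"
    using assms unfolding is_norm_def by blast
  also have "\<dots> = \<bar>1 - t\<bar> * N v + \<bar>t\<bar> * N w"
    using assms unfolding is_norm_def by metis
  also have "\<dots> = (1 - t) * N v + t * N w"
    using t by simp
  finally show "N ((1 - t) *\<^sub>R v + t *\<^sub>R w) \<le> (1 - t) * N v + t * N w" .
qed simp

lemma is_norm_continuous_on:
  fixes N :: "'a::euclidean_space \<Rightarrow> real"
  assumes "is_norm N"
  shows "continuous_on A N"
  using convex_on_continuous[OF open_UNIV is_norm_convex_on[OF assms]]
  by (rule continuous_on_subset) simp

lemma F_feas_alt: "F_feas N \<delta> S x = S \<inter> (\<lambda>z. x + z) ` {z. N z \<le> \<delta>}"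
proof -
  have "y \<in> (\<lambda>z. x + z) ` {z. N z \<le> \<delta>}" if "N (y - x) \<le> \<delta>" for y
    using that by (intro image_eqI[where x = "y - x"]) auto
  then show ?thesis
    unfolding F_feas_def by auto
qed

lemma convex_F_feas:
  assumes "is_norm N" "convex S"
  shows "convex (F_feas N \<delta> S x)"
proof -
  have "convex {z. N z \<le> \<delta>}"
  proof (rule convexI, clarsimp)
    fix v w and s t :: real
    assume le: "N v \<le> \<delta>" "N w \<le> \<delta>" and st: "0 \<le> s" "0 \<le> t" "s + t = 1"
    have "N (s *\<^sub>R v + t *\<^sub>R w) \<le> max (N v) (N w)"
      using convex_lower[OF is_norm_convex_on[OF assms(1)]] st by simp
    with le show "N (s *\<^sub>R v + t *\<^sub>R w) \<le> \<delta>"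
      by simp
  qed
  then show ?thesis
    unfolding F_feas_alt using assms(2) by (intro convex_Int convex_translation) simp_all
qed

lemma compact_F_feas:
  fixes S :: "'a::euclidean_space set"
  assumes "is_norm N" "compact S"
  shows "compact (F_feas N \<delta> S x)"
proof -
  have "closed {z. N z \<le> \<delta>}"
    by (intro closed_Collect_le is_norm_continuous_on[OF assms(1)] continuous_on_const)
  then show ?thesis
    unfolding F_feas_alt using assms(2) by (intro compact_Int_closed closed_translation)
qed

lemma C_feas_pos:
  assumes "(y, \<theta>) \<in> C_feas N \<delta> S c h x"
  shows "\<theta> > 0"
proof (rule ccontr)
  assume "\<not> \<theta> > 0"
  with assms have "\<theta> = 0" "y = 0" "c \<bullet> y + h * \<theta> = 1"
    unfolding C_feas_def by auto
  then show False
    by simp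
qed

text \<open>For positive \<open>\<theta>\<close> the norm constraint and the membership in \<open>\<theta> S\<close> are homogeneous, so
  dividing them by \<open>\<theta>\<close> gives the two constraints of the fractional problem.\<close>

lemma C_feas_iff:
  assumes "is_norm N"
  shows "(y, \<theta>) \<in> C_feas N \<delta> S c h x \<longleftrightarrow>
    \<theta> > 0 \<and> c \<bullet> y + h * \<theta> = 1 \<and> y /\<^sub>R \<theta> \<in> F_feas N \<delta> S x"
proof (cases "\<theta> > 0")
  case True
  have "y - \<theta> *\<^sub>R x = \<theta> *\<^sub>R (y /\<^sub>R \<theta> - x)"
    using True by (simp add: scaleR_diff_right)
  then have "N (y - \<theta> *\<^sub>R x) = \<theta> * N (y /\<^sub>R \<theta> - x)"
    using assms True unfolding is_norm_def by simp
  then have "N (y - \<theta> *\<^sub>R x) \<le> \<theta> * \<delta> \<longleftrightarrow> N (y /\<^sub>R \<theta> - x) \<le> \<delta>"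
    using True by simp
  moreover have "y \<in> (\<lambda>s. \<theta> *\<^sub>R s) ` S \<longleftrightarrow> y /\<^sub>R \<theta> \<in> S"
    using True by (auto intro: image_eqI[where x = "y /\<^sub>R \<theta>"])
  ultimately show ?thesis
    using True unfolding C_feas_def F_feas_def by auto
next
  case False
  then show ?thesis
    using C_feas_pos by blast
qed

text \<open>A convex combination of two points of the cone lies over a convex combination of their
  projections, with weights proportional to \<open>u * \<theta>\<close> and \<open>v * \<eta>\<close> instead of \<open>u\<close> and \<open>v\<close>.\<close>

lemma convex_perspective_cone:
  assumes "convex K"
  shows "convex {(y, \<theta>). \<theta> > (0::real) \<and> y /\<^sub>R \<theta> \<in> K}"
proof (rule convexI, clarsimp)
  fix y z :: 'a and \<theta> \<eta> u v :: real
  assume pos: "\<theta> > 0" "\<eta> > 0" and K: "y /\<^sub>R \<theta> \<in> K" "z /\<^sub>R \<eta> \<in> K"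
    and uv: "0 \<le> u" "0 \<le> v" "u + v = 1"
  define \<tau> where "\<tau> = u * \<theta> + v * \<eta>"
  have "u > 0 \<or> v > 0"
    using uv by linarith
  with pos uv have \<tau>: "\<tau> > 0"
    unfolding \<tau>_def by (auto intro: add_pos_nonneg add_nonneg_pos)
  have "(u * \<theta> / \<tau>) *\<^sub>R (y /\<^sub>R \<theta>) + (v * \<eta> / \<tau>) *\<^sub>R (z /\<^sub>R \<eta>) \<in> K"
    using assms K
  proof (rule convexD)
    show "u * \<theta> / \<tau> + v * \<eta> / \<tau> = 1"
      using \<tau> by (simp add: \<tau>_def flip: add_divide_distrib)
  qed (use \<tau> pos uv in auto)
  also have "(u * \<theta> / \<tau>) *\<^sub>R (y /\<^sub>R \<theta>) + (v * \<eta> / \<tau>) *\<^sub>R (z /\<^sub>R \<eta>)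
      = (u *\<^sub>R y + v *\<^sub>R z) /\<^sub>R \<tau>"
    using pos by (simp add: scaleR_add_right divide_simps)
  finally show "0 < u * \<theta> + v * \<eta> \<and> (u *\<^sub>R y + v *\<^sub>R z) /\<^sub>R (u * \<theta> + v * \<eta>) \<in> K"
    using \<tau> by (simp add: \<tau>_def)
qed

lemma convex_C_feas:
  assumes "is_norm N" "convex S"
  shows "convex (C_feas N \<delta> S c h x)"
proof -
  have "C_feas N \<delta> S c h x =
      {(y, \<theta>). \<theta> > 0 \<and> y /\<^sub>R \<theta> \<in> F_feas N \<delta> S x} \<inter> {w. (c, h) \<bullet> w = 1}"
    using C_feas_iff[OF assms(1)] by (auto simp: inner_prod_def)
  then show ?thesis
    by (simp add: convex_Int convex_perspective_cone convex_F_feas[OF assms] convex_hyperplane)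
qed

lemma concave_on_C_obj:
  assumes "convex X"
  shows "concave_on X (C_obj a g)"
  using assms
  by (auto simp: concave_on_iff C_obj_def inner_add_right algebra_simps)

lemma F_obj_project:
  assumes "\<theta> > 0" "c \<bullet> y + h * \<theta> = 1"
  shows "F_obj a g c h (y /\<^sub>R \<theta>) = C_obj a g (y, \<theta>)"
proof -
  have "c \<bullet> (y /\<^sub>R \<theta>) + h = (c \<bullet> y + h * \<theta>) / \<theta>"
    "a \<bullet> (y /\<^sub>R \<theta>) + g = (a \<bullet> y + g * \<theta>) / \<theta>"
    using assms(1) by (simp_all add: field_simps)
  then show ?thesis
    using assms by (simp add: F_obj_def C_obj_def)
qed

text \<open>The point over \<open>y\<close> on the hyperplane, which shows that every value of the fractional
  problem is a value of the transformed one.\<close>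

lemma C_feas_lift:
  assumes "is_norm N" "y \<in> F_feas N \<delta> S x" "c \<bullet> y + h > 0"
  shows "(y /\<^sub>R (c \<bullet> y + h), 1 / (c \<bullet> y + h)) \<in> C_feas N \<delta> S c h x"
proof -
  have "c \<bullet> (y /\<^sub>R d) + h * (1 / d) = (c \<bullet> y + h) / d" for d
    by (simp add: divide_inverse algebra_simps)
  then show ?thesis
    using assms by (simp add: C_feas_iff)
qed

lemma C_obj_lift: "C_obj a g (y /\<^sub>R (c \<bullet> y + h), 1 / (c \<bullet> y + h)) = F_obj a g c h y"
  by (simp add: C_obj_def F_obj_def divide_inverse algebra_simps)

lemma has_max_value_unique:
  assumes "has_max_value f X v" "has_max_value f X w"
  shows "v = w"
  using assms unfolding has_max_value_def is_arg_max_def by (metis linorder_neqE)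

lemma compact_attains_max_value:
  assumes "compact X" "X \<noteq> {}" "continuous_on X f"
  shows "\<exists>v. has_max_value f X v"
  using continuous_attains_sup[OF assms]
  unfolding has_max_value_def is_arg_max_def by (auto simp: not_less)

text \<open>A strictly better competitor in either problem yields one in the other, since the hypotheses
  make the sets of objective values equal. The map \<open>p\<close> is named because maximisers are to be
  transported along it.\<close>

lemma is_arg_max_transfer:
  assumes p: "\<And>w. w \<in> Y \<Longrightarrow> p w \<in> X \<and> f (p w) = k w"
    and q: "\<And>z. z \<in> X \<Longrightarrow> \<exists>w\<in>Y. k w = f z"
    and "is_arg_max k (\<lambda>w. w \<in> Y) w"
  shows "is_arg_max f (\<lambda>z. z \<in> X) (p w)"
  using assms unfolding is_arg_max_def by metis

lemma has_max_value_transfer: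
  assumes p: "\<And>w. w \<in> Y \<Longrightarrow> p w \<in> X \<and> f (p w) = k w"
    and q: "\<And>z. z \<in> X \<Longrightarrow> \<exists>w\<in>Y. k w = f z"
    and max: "has_max_value f X v"
  shows "has_max_value k Y v"
proof -
  obtain z where z: "is_arg_max f (\<lambda>z. z \<in> X) z" "f z = v"
    using max unfolding has_max_value_def by blast
  then obtain w where w: "w \<in> Y" "k w = v"
    using q unfolding is_arg_max_def by blast
  have "\<not> k w < k w'" if "w' \<in> Y" for w'
    using that p z w unfolding is_arg_max_def by metis
  with w show ?thesis
    unfolding has_max_value_def is_arg_max_def by blast
qed

theorem proposition4:
  fixes S :: "(real ^ 'n) set" and a c x :: "real ^ 'n" and g h \<delta> :: real
    and N :: "real ^ 'n \<Rightarrow> real"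
  assumes "compact S" and "convex S"
    and "\<And>s. s \<in> S \<Longrightarrow> c \<bullet> s + h > 0"
    and "is_norm N"
    and "\<delta> > 0"
    and "x \<in> S"
  shows "has_max_value (F_obj a g c h) (F_feas N \<delta> S x) (f_tilde N \<delta> S a g c h x)
    \<and> convex_max_problem (C_obj a g) (C_feas N \<delta> S c h x)
    \<and> has_max_value (C_obj a g) (C_feas N \<delta> S c h x) (f_tilde N \<delta> S a g c h x)
    \<and> (\<forall>y \<theta>. (y, \<theta>) \<in> C_feas N \<delta> S c h x \<longrightarrow>
          \<theta> > 0 \<and> y /\<^sub>R \<theta> \<in> F_feas N \<delta> S x)
    \<and> (\<forall>y \<theta>. is_arg_max (C_obj a g) (\<lambda>w. w \<in> C_feas N \<delta> S c h x) (y, \<theta>) \<longrightarrow>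
          is_arg_max (F_obj a g c h) (\<lambda>w. w \<in> F_feas N \<delta> S x) (y /\<^sub>R \<theta>))"
proof -
  let ?X = "F_feas N \<delta> S x" and ?f = "F_obj a g c h"
  let ?Y = "C_feas N \<delta> S c h x" and ?k = "C_obj a g"
  let ?p = "\<lambda>(y, \<theta>). y /\<^sub>R \<theta>"
  have pos: "c \<bullet> y + h > 0" if "y \<in> ?X" for y
    using that assms(3) by (simp add: F_feas_def)

  have "x \<in> ?X"
  proof -
    have "N 0 = 0"
      using assms(4) unfolding is_norm_def by blast
    then show ?thesis
      using assms(5,6) by (simp add: F_feas_def)
  qed
  moreover have "continuous_on ?X ?f"
    unfolding F_obj_def using pos by (intro continuous_intros) force
  ultimately obtain v where v: "has_max_value ?f ?X v"
    using compact_attains_max_value[OF compact_F_feas[OF assms(4,1)]] by blast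
  then have max: "has_max_value ?f ?X (f_tilde N \<delta> S a g c h x)"
    unfolding f_tilde_def by (rule theI) (rule has_max_value_unique[OF _ v])

  have convex: "convex_max_problem ?k ?Y"
    by (simp add: convex_max_problem_def convex_C_feas concave_on_C_obj assms(2,4))

  have project: "\<theta> > 0 \<and> y /\<^sub>R \<theta> \<in> ?X \<and> ?f (y /\<^sub>R \<theta>) = ?k (y, \<theta>)" if "(y, \<theta>) \<in> ?Y" for y \<theta>
    using that by (simp add: C_feas_iff[OF assms(4)] F_obj_project)
  then have p: "?p w \<in> ?X \<and> ?f (?p w) = ?k w" if "w \<in> ?Y" for w
    using that by (cases w) simp
  have q: "\<exists>w\<in>?Y. ?k w = ?f y" if "y \<in> ?X" for y
    using C_feas_lift[OF assms(4) that pos[OF that]] C_obj_lift by blast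

  have "has_max_value ?k ?Y (f_tilde N \<delta> S a g c h x)"
    using p q max by (rule has_max_value_transfer)
  moreover have "is_arg_max ?f (\<lambda>w. w \<in> ?X) (y /\<^sub>R \<theta>)"
    if "is_arg_max ?k (\<lambda>w. w \<in> ?Y) (y, \<theta>)" for y \<theta>
    using is_arg_max_transfer[where p = ?p, OF p q that] by simp
  ultimately show ?thesis
    using max convex project by blast
qed

end
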